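(* The meridian surface $\mathcal{M}_m$ parametrized by $$z(u,v) = f(u)\left(\varphi(v)\cosh v\, e_1 + \varphi(v)\sinh v\, e_3 + \frac{\varphi^2(v)}{2}\,\xi_1 + \xi_2\right) + g(u)\,\xi_1,\quad u\in I,\ v\in J,$$ is a surface with flat normal connection, i.e. the curvature of its normal connection $D$ vanishes identically.
   Context: $\mathbb{E}^4_2$ is $\mathbb{R}^4$ with the metric $\langle\cdot,\cdot\rangle$ given by $dx_1^2+dx_2^2-dx_3^2-dx_4^2$, and $e_1,e_2,e_3,e_4$ is a fixed orthonormal basis with $\langle e_1,e_1\rangle=\langle e_2,e_2\rangle=1$, $\langle e_3,e_3\rangle=\langle e_4,e_4\rangle=-1$. Put $\xi_1=\frac{e_2+e_4}{\sqrt2}$, $\xi_2=\frac{-e_2+e_4}{\sqrt2}$, so that $\langle\xi_1,\xi_1\rangle=\langle\xi_2,\xi_2\rangle=0$, $\langle\xi_1,\xi_2\rangle=-1$. Let $I,J\subset\mathbb{R}$ be open intervals, $f,g:I\to\mathbb{R}$ and $\varphi:J\to\mathbb{R}$ smooth with $f>0$. Primes denote derivatives with respect to $u$ and dots denote derivatives of $\varphi$ with respect to $v$. The surface $\mathcal{M}_m$ given by $z(u,v)$ is called a meridian surface; its first fundamental form has coefficients $E=-2f'g'$, $F=0$, $G=f^2(\dot\varphi^2-\varphi^2)$. Only Lorentz surfaces (induced metric of signature $(1,1)$) are considered, so it is assumed that either $\dot\varphi^2-\varphi^2>0$ on $J$ and $f'g'>0$ on $I$ (then put $\varepsilon=1$),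 or $\dot\varphi^2-\varphi^2<0$ on $J$ and $f'g'<0$ on $I$ (then put $\varepsilon=-1$). The normal connection $D$ is defined by the Weingarten formula $\overline\nabla_X\xi=-A_\xi X+D_X\xi$ for tangent $X$ and normal $\xi$, where $\overline\nabla$ is the flat Levi-Civita connection of $\mathbb{E}^4_2$, $-A_\xi X$ is the tangential part and $D_X\xi$ the normal part. *)

theory Defs
  imports "HOL-Analysis.Analysis"
begin

fun Ck_on :: "nat \<Rightarrow> ('a::real_normed_vector) set \<Rightarrow> ('a \<Rightarrow> 'b::real_normed_vector) \<Rightarrow> bool" where
  "Ck_on 0 S F \<longleftrightarrow> continuous_on S F"
| "Ck_on (Suc k) S F \<longleftrightarrow>
     (\<forall>x\<in>S. F differentiable (at x)) \<and>
     (\<forall>w. Ck_on k S (\<lambda>x. frechet_derivative F (at x) w))"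

text \<open>Intended for open \<open>S\<close> only, since the derivatives are taken in the whole space.\<close>

definition smooth_on :: "('a::real_normed_vector) set \<Rightarrow> ('a \<Rightarrow> 'b::real_normed_vector) \<Rightarrow> bool" where
  "smooth_on S F \<longleftrightarrow> (\<forall>k. Ck_on k S F)"

definition sig42 :: "4 \<Rightarrow> real" where
  "sig42 i = (if i = 1 \<or> i = 2 then 1 else - 1)"

definition metric42 :: "real^4 \<Rightarrow> real^4 \<Rightarrow> real" where
  "metric42 x y = (\<Sum>i\<in>UNIV. sig42 i * x $ i * y $ i)"

text \<open>Four vectors with these products are automatically a basis.\<close>

definition orthonormal_basis42 :: "(4 \<Rightarrow> real^4) \<Rightarrow> bool" where
  "orthonormal_basis42 e \<longleftrightarrow>
     (\<forall>i j. metric42 (e i) (e j) = (if i = j then sig42 i else 0))"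

text \<open>
  A parametrized surface is a map \<open>z\<close> from an open set \<open>U\<close> of the parameter plane. Vector
  fields along it are functions on \<open>U\<close>, and a tangent field is represented by its
  coordinate field \<open>X\<close> in the parameter plane, i.e. it is \<open>dz(X)\<close>.
\<close>

definition tangent_space :: "(real \<times> real \<Rightarrow> real^4) \<Rightarrow> real \<times> real \<Rightarrow> (real^4) set" where
  "tangent_space z p = range (frechet_derivative z (at p))"

definition normal_space :: "(real \<times> real \<Rightarrow> real^4) \<Rightarrow> real \<times> real \<Rightarrow> (real^4) set" where
  "normal_space z p = {n. \<forall>t\<in>tangent_space z p. metric42 n t = 0}"

definition first_fundamental_form ::
    "(real \<times> real \<Rightarrow> real^4) \<Rightarrow> real \<times> real \<Rightarrow> real \<times> real \<Rightarrow> real \<times> real \<Rightarrow> real" where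
  "first_fundamental_form z p a b =
     metric42 (frechet_derivative z (at p) a) (frechet_derivative z (at p) b)"

text \<open>Signature \<open>(1,1)\<close> is expressed by the existence of an orthonormal basis of the parameter
  plane with squares \<open>1\<close> and \<open>- 1\<close>; in particular \<open>z\<close> is then an immersion.\<close>

definition lorentz_surface :: "(real \<times> real) set \<Rightarrow> (real \<times> real \<Rightarrow> real^4) \<Rightarrow> bool" where
  "lorentz_surface U z \<longleftrightarrow> open U \<and> smooth_on U z \<and>
     (\<forall>p\<in>U. \<exists>a b. first_fundamental_form z p a a = 1 \<and>
                  first_fundamental_form z p b b = - 1 \<and>
                  first_fundamental_form z p a b = 0)"

text \<open>The normal part is well defined wherever the induced metric is nondegenerate; see
  \<open>ex1_normal_part\<close> below.\<close>

definition normal_part :: "(real \<times> real \<Rightarrow> real^4) \<Rightarrow> real \<times> real \<Rightarrow> real^4 \<Rightarrow> real^4" where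
  "normal_part z p w = (THE n. n \<in> normal_space z p \<and> w - n \<in> tangent_space z p)"

lemma metric42_simps:
  "metric42 (x + y) w = metric42 x w + metric42 y w"
  "metric42 w (x + y) = metric42 w x + metric42 w y"
  "metric42 (x - y) w = metric42 x w - metric42 y w"
  "metric42 w (x - y) = metric42 w x - metric42 w y"
  "metric42 (c *\<^sub>R x) w = c * metric42 x w"
  "metric42 w (c *\<^sub>R x) = c * metric42 w x"
  by (simp_all add: metric42_def algebra_simps sum.distrib sum_subtractf sum_distrib_left)

lemma metric42_commute: "metric42 x y = metric42 y x"
  by (simp add: metric42_def mult.commute mult.left_commute)

lemma ex1_normal_part:
  assumes "lorentz_surface U z" "p \<in> U"
  shows "\<exists>!n. n \<in> normal_space z p \<and> w - n \<in> tangent_space z p"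
proof -
  define L where "L = frechet_derivative z (at p)"
  have "Ck_on (Suc 0) U z"
    using assms(1) unfolding lorentz_surface_def smooth_on_def by blast
  then have "z differentiable (at p)" using assms(2) by simp
  then have lin: "linear L"
    unfolding L_def by (rule linear_frechet_derivative)
  obtain a b where ab: "metric42 (L a) (L a) = 1" "metric42 (L b) (L b) = - 1"
      "metric42 (L a) (L b) = 0"
    using assms unfolding lorentz_surface_def first_fundamental_form_def L_def by blast
  have ba: "metric42 (L b) (L a) = 0" using ab(3) by (simp add: metric42_commute)
  define d where "d = fst a * snd b - fst b * snd a"
  have d: "d \<noteq> 0"
  proof
    assume "d = 0"
    then have *: "snd b *\<^sub>R a - snd a *\<^sub>R b = 0" "fst b *\<^sub>R a - fst a *\<^sub>R b = 0"
      by (auto simp: d_def prod_eq_iff algebra_simps)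
    have L0: "L 0 = 0" using lin by (simp add: linear_0)
    have m0: "metric42 0 x = 0" for x by (simp add: metric42_def)
    have "snd b *\<^sub>R L a - snd a *\<^sub>R L b = 0" "fst b *\<^sub>R L a - fst a *\<^sub>R L b = 0"
      using arg_cong[OF *(1), of L] arg_cong[OF *(2), of L] L0
      by (simp_all add: linear_diff[OF lin] linear_cmul[OF lin])
    then have "metric42 (snd b *\<^sub>R L a - snd a *\<^sub>R L b) (L a) = 0"
        "metric42 (fst b *\<^sub>R L a - fst a *\<^sub>R L b) (L a) = 0"
      by (simp_all add: m0)
    then have "b = 0" by (simp add: metric42_simps ab ba prod_eq_iff)
    then show False using ab(2) L0 m0 by simp
  qed
  have span: "\<exists>x y. L c = x *\<^sub>R L a + y *\<^sub>R L b" for c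
  proof -
    have c: "c = ((fst c * snd b - fst b * snd c) / d) *\<^sub>R a
            + ((fst a * snd c - fst c * snd a) / d) *\<^sub>R b"
      using d by (simp add: prod_eq_iff field_simps) (simp add: d_def algebra_simps)
    show ?thesis
      by (subst c, intro exI) (simp only: linear_add[OF lin] linear_cmul[OF lin])
  qed
  have nsp: "n \<in> normal_space z p \<longleftrightarrow> metric42 n (L a) = 0 \<and> metric42 n (L b) = 0" for n
  proof
    assume "n \<in> normal_space z p"
    then show "metric42 n (L a) = 0 \<and> metric42 n (L b) = 0"
      by (simp add: normal_space_def tangent_space_def L_def del: split_paired_All)
  next
    assume *: "metric42 n (L a) = 0 \<and> metric42 n (L b) = 0"
    have "metric42 n (L c) = 0" for c
      using span[of c] * by (auto simp: metric42_simps)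
    then show "n \<in> normal_space z p"
      by (auto simp: normal_space_def tangent_space_def L_def)
  qed
  define n0 where "n0 = w - (metric42 w (L a) *\<^sub>R L a - metric42 w (L b) *\<^sub>R L b)"
  show ?thesis
  proof (rule ex1I)
    have "w - n0 = L (metric42 w (L a) *\<^sub>R a - metric42 w (L b) *\<^sub>R b)"
      using lin by (simp add: n0_def linear_diff linear_cmul)
    then have "w - n0 \<in> tangent_space z p"
      unfolding tangent_space_def L_def by (rule range_eqI)
    moreover have "n0 \<in> normal_space z p"
      by (simp add: nsp n0_def metric42_simps ab ba)
    ultimately show "n0 \<in> normal_space z p \<and> w - n0 \<in> tangent_space z p" by simp
  next
    fix n assume n: "n \<in> normal_space z p \<and> w - n \<in> tangent_space z p"
    then obtain c where c: "w - n = L c" by (auto simp: tangent_space_def L_def)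
    obtain x y where xy: "L c = x *\<^sub>R L a + y *\<^sub>R L b" using span by blast
    have w: "w = n + (x *\<^sub>R L a + y *\<^sub>R L b)" using c xy by (simp add: algebra_simps)
    have "metric42 w (L a) = x" "metric42 w (L b) = - y"
      using n by (simp_all add: w nsp metric42_simps ab ba)
    then show "n = n0" by (simp add: n0_def w)
  qed
qed

definition smooth_tangent_field :: "(real \<times> real) set \<Rightarrow> (real \<times> real \<Rightarrow> real \<times> real) \<Rightarrow> bool" where
  "smooth_tangent_field U X \<longleftrightarrow> smooth_on U X"

definition smooth_normal_field ::
    "(real \<times> real) set \<Rightarrow> (real \<times> real \<Rightarrow> real^4) \<Rightarrow> (real \<times> real \<Rightarrow> real^4) \<Rightarrow> bool" where
  "smooth_normal_field U z \<xi> \<longleftrightarrow> smooth_on U \<xi> \<and> (\<forall>p\<in>U. \<xi> p \<in> normal_space z p)"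

text \<open>The Weingarten formula: the flat derivative of \<open>\<xi>\<close> along \<open>X\<close> is the directional
  derivative, and the normal connection is its normal part.\<close>

definition normal_connection ::
    "(real \<times> real \<Rightarrow> real^4) \<Rightarrow> (real \<times> real \<Rightarrow> real \<times> real) \<Rightarrow> (real \<times> real \<Rightarrow> real^4)
      \<Rightarrow> real \<times> real \<Rightarrow> real^4" where
  "normal_connection z X \<xi> p = normal_part z p (frechet_derivative \<xi> (at p) (X p))"

definition lie_bracket ::
    "(real \<times> real \<Rightarrow> real \<times> real) \<Rightarrow> (real \<times> real \<Rightarrow> real \<times> real) \<Rightarrow> real \<times> real \<Rightarrow> real \<times> real" where
  "lie_bracket X Y p = frechet_derivative Y (at p) (X p) - frechet_derivative X (at p) (Y p)"

definition normal_curvature ::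
    "(real \<times> real \<Rightarrow> real^4) \<Rightarrow> (real \<times> real \<Rightarrow> real \<times> real) \<Rightarrow> (real \<times> real \<Rightarrow> real \<times> real)
      \<Rightarrow> (real \<times> real \<Rightarrow> real^4) \<Rightarrow> real \<times> real \<Rightarrow> real^4" where
  "normal_curvature z X Y \<xi> p =
     normal_connection z X (normal_connection z Y \<xi>) p
     - normal_connection z Y (normal_connection z X \<xi>) p
     - normal_connection z (lie_bracket X Y) \<xi> p"

definition flat_normal_connection :: "(real \<times> real) set \<Rightarrow> (real \<times> real \<Rightarrow> real^4) \<Rightarrow> bool" where
  "flat_normal_connection U z \<longleftrightarrow>
     (\<forall>X Y \<xi>. smooth_tangent_field U X \<longrightarrow> smooth_tangent_field U Y \<longrightarrow>
        smooth_normal_field U z \<xi> \<longrightarrow> (\<forall>p\<in>U. normal_curvature z X Y \<xi> p = 0))"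

definition xi1 :: "(4 \<Rightarrow> real^4) \<Rightarrow> real^4" where
  "xi1 e = (1 / sqrt 2) *\<^sub>R (e 2 + e 4)"

definition xi2 :: "(4 \<Rightarrow> real^4) \<Rightarrow> real^4" where
  "xi2 e = (1 / sqrt 2) *\<^sub>R (- e 2 + e 4)"

definition meridian_surface ::
    "(4 \<Rightarrow> real^4) \<Rightarrow> (real \<Rightarrow> real) \<Rightarrow> (real \<Rightarrow> real) \<Rightarrow> (real \<Rightarrow> real) \<Rightarrow> real \<times> real \<Rightarrow> real^4" where
  "meridian_surface e f g \<phi> = (\<lambda>(u, v).
     f u *\<^sub>R ((\<phi> v * cosh v) *\<^sub>R e 1 + (\<phi> v * sinh v) *\<^sub>R e 3 + ((\<phi> v)\<^sup>2 / 2) *\<^sub>R xi1 e + xi2 e)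
     + g u *\<^sub>R xi1 e)"

end

theory Submission
  imports Defs
begin

text \<open>
  The reason for flatness is that the normal bundle carries a parallel frame. Write
  \<open>z = f l + g \<xi>\<^sub>1\<close>, where \<open>l(v)\<close> is a curve in the light cone with \<open>\<langle>l, \<xi>\<^sub>1\<rangle> = - 1\<close>. Since
  \<open>z\<^sub>u = f' l + g' \<xi>\<^sub>1\<close> and \<open>z\<^sub>v = f l'\<close>, there are two obvious orthogonal normal directions:
  one in the plane of \<open>l\<close> and \<open>\<xi>\<^sub>1\<close>, namely \<open>f' l - g' \<xi>\<^sub>1\<close>, and one, \<open>n(v)\<close>, orthogonal
  to all of \<open>l\<close>, \<open>l'\<close>, \<open>\<xi>\<^sub>1\<close>, which does not depend on \<open>u\<close>. Both are nonnull; let \<open>N\<^sub>1\<close>, \<open>N\<^sub>2\<close> be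
  the normalizations of \<open>n\<close> and \<open>f' l - g' \<xi>\<^sub>1\<close>.

  Derivatives of \<open>N\<^sub>1\<close> are orthogonal to \<open>\<xi>\<^sub>1\<close>, which is constant, and to \<open>l\<close>, because
  \<open>\<langle>N\<^sub>1, l\<rangle> = 0\<close> and \<open>\<langle>N\<^sub>1, l'\<rangle> = 0\<close>; hence they are orthogonal to \<open>N\<^sub>2\<close>. For a pseudo-orthonormal
  frame of a rank two bundle the function \<open>\<langle>dN\<^sub>1, N\<^sub>2\<rangle>\<close> is the only connection coefficient, so
  its vanishing makes \<open>N\<^sub>1\<close> and \<open>N\<^sub>2\<close> parallel (\<open>torsion_free_frame_parallel\<close>).

  A parallel frame forces the curvature to vanish: for a normal field \<open>\<xi>\<close> and
  \<open>a = \<langle>\<xi>, N\<rangle>\<close> with \<open>N\<close> parallel one has \<open>\<langle>D\<^sub>X \<xi>, N\<rangle> = X a\<close>, so the curvature has component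
  \<open>X (Y a) - Y (X a) - [X, Y] a\<close> along \<open>N\<close>, and this is zero by the symmetry of second derivatives
  (\<open>dir_deriv_commute\<close>, \<open>lie_bracket_commutator\<close>).
\<close>

section \<open>Functions of class Ck on open sets\<close>

abbreviation dir_deriv :: "('a::real_normed_vector \<Rightarrow> 'b::real_normed_vector) \<Rightarrow> 'a \<Rightarrow> 'a \<Rightarrow> 'b" where
  "dir_deriv F w \<equiv> (\<lambda>x. frechet_derivative F (at x) w)"

lemma dir_deriv_eqI: "(F has_derivative F') (at x) \<Longrightarrow> dir_deriv F w x = F' w"
  by (metis frechet_derivative_at)

lemma has_derivative_dir_deriv:
  "F differentiable (at x) \<Longrightarrow> (F has_derivative (\<lambda>w. dir_deriv F w x)) (at x)"
  by (simp add: frechet_derivative_works)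

lemma has_derivative_cong_open:
  assumes "open S" "x \<in> S" "\<And>y. y \<in> S \<Longrightarrow> F y = G y"
  shows "(F has_derivative F') (at x) \<longleftrightarrow> (G has_derivative F') (at x)"
  using assms by (metis has_derivative_transform_within_open)

lemma dir_deriv_cong_open:
  assumes "open S" "x \<in> S" "\<And>y. y \<in> S \<Longrightarrow> F y = G y"
  shows "dir_deriv F w x = dir_deriv G w x"
proof -
  have "(F has_derivative F') (at x) \<longleftrightarrow> (G has_derivative F') (at x)" for F'
    using assms by (rule has_derivative_cong_open)
  then show ?thesis by (simp add: frechet_derivative_def)
qed

lemma differentiable_cong_open:
  assumes "open S" "x \<in> S" "\<And>y. y \<in> S \<Longrightarrow> F y = G y"
  shows "F differentiable (at x) \<longleftrightarrow> G differentiable (at x)"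
  using has_derivative_cong_open[OF assms(1,2), of F G] assms(3) unfolding differentiable_def by simp

lemma Ck_on_cong:
  assumes "open S" "\<And>x. x \<in> S \<Longrightarrow> F x = G x"
  shows "Ck_on k S F \<longleftrightarrow> Ck_on k S G"
  using assms(2)
proof (induction k arbitrary: F G)
  case 0
  then show ?case by (simp add: continuous_on_def cong: Lim_cong_within)
next
  case (Suc k)
  have "F differentiable at x \<longleftrightarrow> G differentiable at x" if "x \<in> S" for x
    unfolding differentiable_def using has_derivative_cong_open[OF assms(1) that] Suc.prems by blast
  moreover have "Ck_on k S (dir_deriv F w) \<longleftrightarrow> Ck_on k S (dir_deriv G w)" for w
    by (rule Suc.IH) (rule dir_deriv_cong_open[OF assms(1)], auto simp: Suc.prems)
  ultimately show ?case by auto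
qed

text \<open>This avoids the choice operator behind \<open>frechet_derivative\<close>: any explicitly known derivative
  may be used to check the class of a function.\<close>

lemma Ck_on_SucI:
  assumes "open S" "\<And>x. x \<in> S \<Longrightarrow> (F has_derivative F' x) (at x)"
    "\<And>w. Ck_on k S (\<lambda>x. F' x w)"
  shows "Ck_on (Suc k) S F"
proof -
  have "Ck_on k S (dir_deriv F w)" for w
    using Ck_on_cong[OF assms(1), of "dir_deriv F w" "\<lambda>x. F' x w"] assms(3)
      dir_deriv_eqI[OF assms(2)] by blast
  then show ?thesis using assms(2) by (auto simp: differentiable_def)
qed

lemma Ck_on_SucD:
  assumes "Ck_on (Suc k) S F"
  shows "Ck_on k S F"
  using assms
proof (induction k arbitrary: F)
  case 0
  then show ?case
    by (auto intro!: continuous_at_imp_continuous_on differentiable_imp_continuous_within)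
next
  case (Suc k)
  from Suc.prems show ?case
    by (metis Ck_on.simps(2) Suc.IH)
qed

lemma Ck_on_const: "Ck_on k S (\<lambda>x. c)"
proof (induction k arbitrary: c)
  case (Suc k)
  have "(\<lambda>x. frechet_derivative (\<lambda>x. c) (at x) w) = (\<lambda>x. 0)" for w :: 'a
    by (rule ext) (rule dir_deriv_eqI, simp)
  with Suc show ?case by simp
qed simp

lemma Ck_on_add:
  assumes "open S" "Ck_on k S F" "Ck_on k S G"
  shows "Ck_on k S (\<lambda>x. F x + G x)"
  using assms(2,3)
proof (induction k arbitrary: F G)
  case 0
  then show ?case by (simp add: continuous_on_add)
next
  case (Suc k)
  show ?case
  proof (rule Ck_on_SucI[OF assms(1)])
    show "((\<lambda>x. F x + G x) has_derivative (\<lambda>w. dir_deriv F w x + dir_deriv G w x)) (at x)"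
      if "x \<in> S" for x
      using Suc.prems that by (intro has_derivative_add has_derivative_dir_deriv) auto
  qed (use Suc in auto)
qed

text \<open>By the product rule a directional derivative is a sum of two terms of the same form, in which
  one factor has been differentiated once; so the induction on \<open>k\<close> runs over all pairs of
  factors. Applied to multiplication, to \<open>scaleR\<close> and to the indefinite metric.\<close>

lemma Ck_on_bilinear:
  assumes "bounded_bilinear B" "open S" "Ck_on k S F" "Ck_on k S G"
  shows "Ck_on k S (\<lambda>x. B (F x) (G x))"
  using assms(3,4)
proof (induction k arbitrary: F G)
  case 0
  then show ?case by (simp add: bounded_bilinear.continuous_on[OF assms(1)])
next
  case (Suc k)
  show ?case
  proof (rule Ck_on_SucI[OF assms(2)])
    show "((\<lambda>x. B (F x) (G x)) has_derivative
        (\<lambda>w. B (F x) (dir_deriv G w x) + B (dir_deriv F w x) (G x))) (at x)"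
      if "x \<in> S" for x
      using Suc.prems that
      by (intro bounded_bilinear.FDERIV[OF assms(1)] has_derivative_dir_deriv) auto
    show "Ck_on k S (\<lambda>x. B (F x) (dir_deriv G w x) + B (dir_deriv F w x) (G x))" for w
      using Suc.IH Suc.prems Ck_on_SucD[OF Suc.prems(1)] Ck_on_SucD[OF Suc.prems(2)]
      by (intro Ck_on_add assms(2)) auto
  qed
qed

text \<open>A linear inner map makes the chain rule trivial to iterate: the direction \<open>L w\<close> does not
  depend on the point, so the derivative is again a composition with \<open>L\<close>. This suffices to regard
  functions of \<open>u\<close> or of \<open>v\<close> as functions on the parameter plane.\<close>

lemma Ck_on_compose_linear:
  assumes "bounded_linear L" "open S" "\<And>x. x \<in> S \<Longrightarrow> L x \<in> T" "Ck_on k T F"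
  shows "Ck_on k S (\<lambda>x. F (L x))"
  using assms(4)
proof (induction k arbitrary: F)
  case 0
  then show ?case
    using assms(1,3)
    by (auto intro: continuous_on_compose2[OF _ linear_continuous_on])
next
  case (Suc k)
  show ?case
  proof (rule Ck_on_SucI[OF assms(2)])
    show "((\<lambda>x. F (L x)) has_derivative (\<lambda>w. dir_deriv F (L w) (L x))) (at x)"
      if "x \<in> S" for x
      using has_derivative_compose[OF bounded_linear_imp_has_derivative[OF assms(1)]
          has_derivative_dir_deriv[of F "L x"]] Suc.prems that assms(3) by auto
  qed (use Suc in auto)
qed

text \<open>Real exponents are closed under differentiation, so one induction over all \<open>r\<close> covers
  reciprocals and square roots at once; the frame fields are normalized with \<open>r = - 1/2\<close>.\<close>

lemma Ck_on_powr:
  fixes h :: "'a::real_normed_vector \<Rightarrow> real"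
  assumes "open S" "Ck_on k S h" "\<And>x. x \<in> S \<Longrightarrow> h x > 0"
  shows "Ck_on k S (\<lambda>x. h x powr r)"
  using assms(2)
proof (induction k arbitrary: r)
  case 0
  then show ?case using assms(3) by (auto intro!: continuous_intros simp: less_le)
next
  case (Suc k)
  show ?case
  proof (rule Ck_on_SucI[OF assms(1)])
    show "((\<lambda>x. h x powr r) has_derivative (\<lambda>w. (r * h x powr (r - 1)) * dir_deriv h w x)) (at x)"
      if "x \<in> S" for x
    proof -
      have "(h has_derivative (\<lambda>w. dir_deriv h w x)) (at x)"
        using Suc.prems that by (intro has_derivative_dir_deriv) auto
      moreover have "((\<lambda>y. y powr r) has_field_derivative r * h x powr (r - 1)) (at (h x))"
        using assms(3)[OF that] by (rule has_real_derivative_powr)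
      ultimately show ?thesis
        by (rule has_derivative_compose[unfolded has_field_derivative_def, 
              OF _ has_field_derivative_imp_has_derivative])
    qed
    show "Ck_on k S (\<lambda>x. (r * h x powr (r - 1)) * dir_deriv h w x)" for w
      using Suc.prems Suc.IH[OF Ck_on_SucD[OF Suc.prems]]
      by (intro Ck_on_bilinear[OF bounded_bilinear_mult assms(1)] Ck_on_const) auto
  qed
qed

lemma Ck_on_cosh_sinh:
  fixes S :: "real set"
  assumes "open S"
  shows "Ck_on k S cosh \<and> Ck_on k S sinh"
proof (induction k)
  case 0
  then show ?case by (simp add: continuous_intros)
next
  case (Suc k)
  have d: "(cosh has_derivative (\<lambda>w. sinh x * w)) (at x)"
    "(sinh has_derivative (\<lambda>w. cosh x * w)) (at x)" for x :: real
    by (auto intro!: derivative_eq_intros simp: has_field_derivative_def[symmetric])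
  show ?case
    using Suc
    by (intro conjI Ck_on_SucI[OF assms d(1)] Ck_on_SucI[OF assms d(2)]
        Ck_on_bilinear[OF bounded_bilinear_mult assms] Ck_on_const) auto
qed

lemma smooth_on_differentiable: "smooth_on S F \<Longrightarrow> x \<in> S \<Longrightarrow> F differentiable (at x)"
  unfolding smooth_on_def by (metis Ck_on.simps(2))

lemma smooth_on_dir_deriv: "smooth_on S F \<Longrightarrow> smooth_on S (dir_deriv F w)"
  unfolding smooth_on_def by (metis Ck_on.simps(2))

lemma smooth_on_const: "smooth_on S (\<lambda>x. c)"
  by (simp add: smooth_on_def Ck_on_const)

lemma smooth_on_add: "open S \<Longrightarrow> smooth_on S F \<Longrightarrow> smooth_on S G \<Longrightarrow> smooth_on S (\<lambda>x. F x + G x)"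
  by (simp add: smooth_on_def Ck_on_add)

lemma smooth_on_bilinear:
  "bounded_bilinear B \<Longrightarrow> open S \<Longrightarrow> smooth_on S F \<Longrightarrow> smooth_on S G \<Longrightarrow> smooth_on S (\<lambda>x. B (F x) (G x))"
  by (simp add: smooth_on_def Ck_on_bilinear)

lemmas smooth_on_scaleR = smooth_on_bilinear[OF bounded_bilinear_scaleR]
  and smooth_on_mult = smooth_on_bilinear[OF bounded_bilinear_mult]

lemma smooth_on_diff:
  assumes "open S" "smooth_on S F" "smooth_on S G"
  shows "smooth_on S (\<lambda>x. F x - G x)"
  using smooth_on_add[OF assms(1,2) smooth_on_scaleR[OF assms(1) smooth_on_const[of S "- 1"] assms(3)]]
  by simp

lemma smooth_on_powr:
  fixes h :: "'a::real_normed_vector \<Rightarrow> real"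
  shows "open S \<Longrightarrow> smooth_on S h \<Longrightarrow> (\<And>x. x \<in> S \<Longrightarrow> h x > 0) \<Longrightarrow> smooth_on S (\<lambda>x. h x powr r)"
  by (simp add: smooth_on_def Ck_on_powr)

lemma smooth_on_fst:
  fixes F :: "real \<Rightarrow> 'b::real_normed_vector"
  assumes "open I" "open J" "smooth_on I F"
  shows "smooth_on (I \<times> J) (\<lambda>p. F (fst p))"
  unfolding smooth_on_def
  by (intro allI Ck_on_compose_linear[OF bounded_linear_fst, where T = I])
     (use assms in \<open>auto simp: smooth_on_def open_Times\<close>)

lemma smooth_on_snd:
  fixes F :: "real \<Rightarrow> 'b::real_normed_vector"
  assumes "open I" "open J" "smooth_on J F"
  shows "smooth_on (I \<times> J) (\<lambda>p. F (snd p))"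
  unfolding smooth_on_def
  by (intro allI Ck_on_compose_linear[OF bounded_linear_snd, where T = J])
     (use assms in \<open>auto simp: smooth_on_def open_Times\<close>)

lemma smooth_on_deriv:
  fixes F :: "real \<Rightarrow> real"
  assumes "open S" "smooth_on S F"
  shows "smooth_on S (deriv F)"
    and "x \<in> S \<Longrightarrow> (F has_field_derivative deriv F x) (at x)"
proof -
  have D: "(F has_field_derivative deriv F x) (at x)" if "x \<in> S" for x
    using smooth_on_differentiable[OF assms(2) that]
    by (simp add: DERIV_deriv_iff_real_differentiable)
  then show "x \<in> S \<Longrightarrow> (F has_field_derivative deriv F x) (at x)" .
  have "dir_deriv F 1 x = deriv F x" if "x \<in> S" for x
    using dir_deriv_eqI[OF has_field_derivative_imp_has_derivative[OF D[OF that]], of 1] by simp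
  then show "smooth_on S (deriv F)"
    using smooth_on_dir_deriv[OF assms(2), of 1] Ck_on_cong[OF assms(1), of "dir_deriv F 1" "deriv F"]
    by (simp add: smooth_on_def)
qed

lemma smooth_on_cosh_sinh:
  fixes S :: "real set"
  shows "open S \<Longrightarrow> smooth_on S cosh" "open S \<Longrightarrow> smooth_on S sinh"
  by (simp_all add: smooth_on_def Ck_on_cosh_sinh)

section \<open>Symmetry of second derivatives\<close>

text \<open>The second difference of \<open>a\<close> over a small parallelogram is a value of the mixed second
  derivative somewhere in it, by the mean value theorem in each of the two directions.
  Since the second difference is symmetric in \<open>w1\<close> and \<open>w2\<close>, this will give the symmetry of second derivatives.\<close>

lemma parallelogram_mean_value:
  fixes a :: "'a::real_normed_vector \<Rightarrow> real"
  assumes "0 < h" and C2: "Ck_on 2 S a"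
    and S: "\<And>s t. \<lbrakk>0 \<le> s; s \<le> h; 0 \<le> t; t \<le> h\<rbrakk> \<Longrightarrow> p + s *\<^sub>R w1 + t *\<^sub>R w2 \<in> S"
  obtains s t where "0 \<le> s" "s \<le> h" "0 \<le> t" "t \<le> h"
    "a (p + h *\<^sub>R w1 + h *\<^sub>R w2) - a (p + h *\<^sub>R w1) - a (p + h *\<^sub>R w2) + a p
     = h\<^sup>2 * dir_deriv (dir_deriv a w1) w2 (p + s *\<^sub>R w1 + t *\<^sub>R w2)"
proof -
  have line: "((\<lambda>s. F (q + s *\<^sub>R w)) has_field_derivative dir_deriv F w (q + s *\<^sub>R w)) (at s)"
    if "F differentiable at (q + s *\<^sub>R w)" for F :: "'a \<Rightarrow> real" and q s w
  proof -
    have "((\<lambda>s. q + s *\<^sub>R w) has_derivative (\<lambda>r. r *\<^sub>R w)) (at s)"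
      by (auto intro!: derivative_eq_intros)
    from has_derivative_compose[OF this has_derivative_dir_deriv[OF that]]
    have *: "((\<lambda>s. F (q + s *\<^sub>R w)) has_derivative
       (\<lambda>r. frechet_derivative F (at (q + s *\<^sub>R w)) (r *\<^sub>R w))) (at s)" .
    have "frechet_derivative F (at (q + s *\<^sub>R w)) (r *\<^sub>R w) = dir_deriv F w (q + s *\<^sub>R w) * r" for r
      using linear_frechet_derivative[OF that] by (simp add: linear_cmul)
    with * show ?thesis by (simp add: has_field_derivative_def fun_eq_iff[symmetric])
  qed
  have da: "a differentiable at q" "dir_deriv a w1 differentiable at q" if "q \<in> S" for q
    using C2 that by (auto simp: numeral_2_eq_2)
  define F where "F s = a ((p + h *\<^sub>R w2) + s *\<^sub>R w1) - a (p + s *\<^sub>R w1)" for s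
  have "(F has_field_derivative dir_deriv a w1 ((p + h *\<^sub>R w2) + s *\<^sub>R w1)
           - dir_deriv a w1 (p + s *\<^sub>R w1)) (at s)" if "0 \<le> s" "s \<le> h" for s
    unfolding F_def
    by (intro DERIV_diff line da)
       (use that S[of s h] S[of s 0] \<open>0 < h\<close> in \<open>auto simp: algebra_simps\<close>)
  from MVT2[OF \<open>0 < h\<close> this] obtain s where s: "0 < s" "s < h" and
    Fs: "F h - F 0 = h * (dir_deriv a w1 ((p + h *\<^sub>R w2) + s *\<^sub>R w1) - dir_deriv a w1 (p + s *\<^sub>R w1))"
    by auto
  have "((\<lambda>t. dir_deriv a w1 ((p + s *\<^sub>R w1) + t *\<^sub>R w2)) has_field_derivative
      dir_deriv (dir_deriv a w1) w2 ((p + s *\<^sub>R w1) + t *\<^sub>R w2)) (at t)" if "0 \<le> t" "t \<le> h" for t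
    by (intro line da) (use that S[of s t] s in auto)
  from MVT2[OF \<open>0 < h\<close> this] obtain t where t: "0 < t" "t < h" and
    "dir_deriv a w1 ((p + s *\<^sub>R w1) + h *\<^sub>R w2) - dir_deriv a w1 ((p + s *\<^sub>R w1) + 0 *\<^sub>R w2)
      = h * dir_deriv (dir_deriv a w1) w2 ((p + s *\<^sub>R w1) + t *\<^sub>R w2)"
    by auto
  with Fs have "F h - F 0 = h\<^sup>2 * dir_deriv (dir_deriv a w1) w2 (p + s *\<^sub>R w1 + t *\<^sub>R w2)"
    by (simp add: power2_eq_square algebra_simps)
  then show thesis
    using s t by (intro that[of s t]) (auto simp: F_def algebra_simps)
qed

text \<open>If the two mixed derivatives \<open>A\<close>, \<open>B\<close> differed at \<open>p\<close>, then near \<open>p\<close> their values would stay closer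
  to \<open>A p\<close> and \<open>B p\<close> than half the gap; but on a small parallelogram both of them attain a common
  value, the second difference divided by \<open>h\<^sup>2\<close>.\<close>

lemma dir_deriv_commute:
  fixes a :: "'a::real_normed_vector \<Rightarrow> real"
  assumes "open S" "Ck_on 2 S a" "p \<in> S"
  shows "dir_deriv (dir_deriv a w1) w2 p = dir_deriv (dir_deriv a w2) w1 p"
proof (rule ccontr)
  define A where "A = dir_deriv (dir_deriv a w1) w2"
  define B where "B = dir_deriv (dir_deriv a w2) w1"
  assume "dir_deriv (dir_deriv a w1) w2 p \<noteq> dir_deriv (dir_deriv a w2) w1 p"
  then have e: "dist (A p) (B p) > 0" by (simp add: A_def B_def)
  have "continuous_on S A" "continuous_on S B"
    using assms(2) by (auto simp: A_def B_def numeral_2_eq_2)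
  then have "isCont A p" "isCont B p"
    using assms by (auto simp: continuous_on_eq_continuous_at)
  then have "(A \<longlongrightarrow> A p) (nhds p)" "(B \<longlongrightarrow> B p) (nhds p)"
    by (simp_all add: isCont_def tendsto_at_iff_tendsto_nhds)
  then have "\<forall>\<^sub>F q in nhds p. dist (A q) (A p) < dist (A p) (B p) / 2"
    "\<forall>\<^sub>F q in nhds p. dist (B q) (B p) < dist (A p) (B p) / 2"
    using half_gt_zero[OF e] by (blast intro: tendstoD)+
  moreover have "\<forall>\<^sub>F q in nhds p. q \<in> S" using assms by (simp add: eventually_nhds_in_open)
  ultimately have "\<forall>\<^sub>F q in nhds p. q \<in> S \<and> dist (A q) (A p) < dist (A p) (B p) / 2
      \<and> dist (B q) (B p) < dist (A p) (B p) / 2"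
    by eventually_elim auto
  then obtain r where r: "r > 0" and near: "\<And>q. dist q p < r \<Longrightarrow> q \<in> S
      \<and> dist (A q) (A p) < dist (A p) (B p) / 2 \<and> dist (B q) (B p) < dist (A p) (B p) / 2"
    unfolding eventually_nhds_metric by auto
  \<comment> \<open>Makes the parallelogram with sides \<open>h w1\<close>, \<open>h w2\<close> fit into the ball of radius \<open>r\<close>; the summand 1 covers \<open>w1 = w2 = 0\<close>.\<close>
  define h where "h = r / (norm w1 + norm w2 + 1)"
  have h: "h > 0" using r by (simp add: h_def add_nonneg_pos)
  have small: "dist (p + s *\<^sub>R w1 + t *\<^sub>R w2) p < r"
    if "0 \<le> s" "s \<le> h" "0 \<le> t" "t \<le> h" for s t
  proof -
    have "dist (p + s *\<^sub>R w1 + t *\<^sub>R w2) p = norm (s *\<^sub>R w1 + t *\<^sub>R w2)"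
      by (simp add: dist_norm algebra_simps)
    also have "\<dots> \<le> s * norm w1 + t * norm w2"
      using norm_triangle_ineq[of "s *\<^sub>R w1" "t *\<^sub>R w2"] that by simp
    also have "\<dots> \<le> h * norm w1 + h * norm w2"
      using that by (intro add_mono mult_right_mono) auto
    also have "\<dots> < h * (norm w1 + norm w2 + 1)" using h by (simp add: algebra_simps)
    also have "\<dots> = r" 
      using norm_ge_zero[of w1] norm_ge_zero[of w2] unfolding h_def by (simp add: add_nonneg_eq_0_iff)
    finally show ?thesis .
  qed
  have swap: "p + s *\<^sub>R w2 + t *\<^sub>R w1 = p + t *\<^sub>R w1 + s *\<^sub>R w2" for s t by simp
  obtain s t where st: "0 \<le> s" "s \<le> h" "0 \<le> t" "t \<le> h"
    "a (p + h *\<^sub>R w1 + h *\<^sub>R w2) - a (p + h *\<^sub>R w1) - a (p + h *\<^sub>R w2) + a p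
     = h\<^sup>2 * A (p + s *\<^sub>R w1 + t *\<^sub>R w2)"
    using parallelogram_mean_value[OF h assms(2), of p w1 w2] near[OF small] unfolding A_def by metis
  obtain s' t' where st': "0 \<le> s'" "s' \<le> h" "0 \<le> t'" "t' \<le> h"
    "a (p + h *\<^sub>R w2 + h *\<^sub>R w1) - a (p + h *\<^sub>R w2) - a (p + h *\<^sub>R w1) + a p
     = h\<^sup>2 * B (p + s' *\<^sub>R w2 + t' *\<^sub>R w1)"
    using parallelogram_mean_value[OF h assms(2), of p w2 w1] near[OF small] swap
    unfolding B_def by metis
  have "h\<^sup>2 * A (p + s *\<^sub>R w1 + t *\<^sub>R w2) = h\<^sup>2 * B (p + t' *\<^sub>R w1 + s' *\<^sub>R w2)"
    using st(5) st'(5) unfolding swap by linarith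
  then have "A (p + s *\<^sub>R w1 + t *\<^sub>R w2) = B (p + t' *\<^sub>R w1 + s' *\<^sub>R w2)" using h by simp
  then show False
    using near[OF small[OF st(1-4)]] near[OF small[OF st'(3,4,1,2)]]
      dist_triangle2[of "A p" "B p" "A (p + s *\<^sub>R w1 + t *\<^sub>R w2)"]
    by (simp add: dist_commute)
qed

text \<open>In coordinates, the second order terms of \<open>X (Y a) - Y (X a)\<close> cancel by symmetry of the
  Hessian of \<open>a\<close>, and the remaining first order terms come from differentiating the coefficients of \<open>Y\<close> and \<open>X\<close>.\<close>

lemma lie_bracket_commutator:
  fixes a :: "real \<times> real \<Rightarrow> real"
  assumes "open U" "p \<in> U" "Ck_on 2 U a" "smooth_on U X" "smooth_on U Y"
  shows "dir_deriv (\<lambda>q. dir_deriv a (Y q) q) (X p) p - dir_deriv (\<lambda>q. dir_deriv a (X q) q) (Y p) p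
    = dir_deriv a (lie_bracket X Y p) p"
    and "(\<lambda>q. dir_deriv a (Y q) q) differentiable (at p)"
proof -
  define a1 where "a1 = dir_deriv a (1, 0)"
  define a2 where "a2 = dir_deriv a (0, 1)"
  have diff: "F differentiable at q \<Longrightarrow>
      dir_deriv F w q = fst w * dir_deriv F (1, 0) q + snd w * dir_deriv F (0, 1) q"
    for F :: "real \<times> real \<Rightarrow> real" and w q
  proof -
    assume "F differentiable at q"
    then have l: "linear (\<lambda>w. dir_deriv F w q)" by (rule linear_frechet_derivative)
    have "dir_deriv F w q = dir_deriv F (fst w *\<^sub>R (1, 0) + snd w *\<^sub>R (0, 1)) q" by simp
    also have "\<dots> = fst w * dir_deriv F (1, 0) q + snd w * dir_deriv F (0, 1) q"
      by (simp only: linear_add[OF l] linear_cmul[OF l] real_scaleR_def)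
    finally show "dir_deriv F w q = fst w * dir_deriv F (1, 0) q + snd w * dir_deriv F (0, 1) q" .
  qed
  have da: "a differentiable at q" "a1 differentiable at q" "a2 differentiable at q" if "q \<in> U" for q
    using assms(3) that by (auto simp: numeral_2_eq_2 a1_def a2_def)
  have der: "((\<lambda>q. dir_deriv a (V q) q) has_derivative (\<lambda>w.
        (fst (V p) * dir_deriv a1 w p + fst (dir_deriv V w p) * a1 p)
      + (snd (V p) * dir_deriv a2 w p + snd (dir_deriv V w p) * a2 p))) (at p)"
    if "smooth_on U V" for V
  proof -
    have "(V has_derivative (\<lambda>w. dir_deriv V w p)) (at p)"
      using that assms(2) by (intro has_derivative_dir_deriv smooth_on_differentiable)
    then have "((\<lambda>q. fst (V q) * a1 q + snd (V q) * a2 q) has_derivative (\<lambda>w.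
        (fst (V p) * dir_deriv a1 w p + fst (dir_deriv V w p) * a1 p)
      + (snd (V p) * dir_deriv a2 w p + snd (dir_deriv V w p) * a2 p))) (at p)"
      using da assms(2)
      by (intro has_derivative_add has_derivative_mult has_derivative_fst has_derivative_snd
          has_derivative_dir_deriv[OF da(2)] has_derivative_dir_deriv[OF da(3)])
    moreover have "fst (V q) * a1 q + snd (V q) * a2 q = dir_deriv a (V q) q" if "q \<in> U" for q
      using diff[OF da(1)[OF that], of "V q"] by (simp only: a1_def a2_def)
    ultimately show ?thesis
      by (rule iffD1[OF has_derivative_cong_open[OF assms(1,2)], rotated])
  qed
  show "(\<lambda>q. dir_deriv a (Y q) q) differentiable (at p)"
    using der[OF assms(5)] unfolding differentiable_def by blast
  have lhs: "dir_deriv (\<lambda>q. dir_deriv a (V q) q) w p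
      = (fst (V p) * dir_deriv a1 w p + fst (dir_deriv V w p) * a1 p)
        + (snd (V p) * dir_deriv a2 w p + snd (dir_deriv V w p) * a2 p)" if "smooth_on U V" for V w
    by (rule dir_deriv_eqI[OF der[OF that]])
  define H where "H = dir_deriv a2 (1, 0) p"
  have sym: "dir_deriv a1 (0, 1) p = H"
    unfolding a1_def a2_def H_def by (rule dir_deriv_commute[OF assms(1,3,2)])
  have second: "dir_deriv a1 w p = fst w * dir_deriv a1 (1, 0) p + snd w * H"
    "dir_deriv a2 w p = fst w * H + snd w * dir_deriv a2 (0, 1) p" for w
    unfolding sym[symmetric]
    using diff[OF da(2)[OF assms(2)], of w] diff[OF da(3)[OF assms(2)], of w] sym
    by (simp_all only: H_def)
  have "dir_deriv (\<lambda>q. dir_deriv a (Y q) q) (X p) p - dir_deriv (\<lambda>q. dir_deriv a (X q) q) (Y p) p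
    = fst (lie_bracket X Y p) * a1 p + snd (lie_bracket X Y p) * a2 p"
    unfolding lhs[OF assms(4)] lhs[OF assms(5)] second[of "X p"] second[of "Y p"]
    by (simp only: lie_bracket_def fst_diff snd_diff algebra_simps)
  also have "\<dots> = dir_deriv a (lie_bracket X Y p) p"
    using diff[OF da(1)[OF assms(2)], of "lie_bracket X Y p"] by (simp only: a1_def a2_def)
  finally show "dir_deriv (\<lambda>q. dir_deriv a (Y q) q) (X p) p - dir_deriv (\<lambda>q. dir_deriv a (X q) q) (Y p) p
    = dir_deriv a (lie_bracket X Y p) p" .
qed

section \<open>Parallel normal frames\<close>

lemma bounded_bilinear_metric42: "bounded_bilinear metric42"
  by (simp flip: bilinear_conv_bounded_bilinear add: bilinear_def linear_iff metric42_simps)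

text \<open>Pairwise orthogonal nonnull vectors are linearly independent, so four of them span the space,
  and the metric is nondegenerate.\<close>

lemma zero_if_orthogonal_to_frame:
  fixes b :: "4 \<Rightarrow> real^4"
  assumes orth: "\<And>i j. i \<noteq> j \<Longrightarrow> metric42 (b i) (b j) = 0"
    and nonnull: "\<And>i. metric42 (b i) (b i) \<noteq> 0"
    and perp: "\<And>i. metric42 w (b i) = 0"
  shows "w = 0"
proof -
  have lin: "linear (metric42 x)" for x by (simp add: linear_iff metric42_simps)
  have "inj b" by (rule injI) (metis orth nonnull)
  have "independent (range b)"
  proof
    assume "dependent (range b)"
    then obtain u v where v: "v \<in> range b" "u v \<noteq> 0" and 0: "(\<Sum>x\<in>range b. u x *\<^sub>R x) = 0"
      by (auto simp: dependent_finite)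
    have "0 = metric42 v (\<Sum>x\<in>range b. u x *\<^sub>R x)" using 0 lin by (simp add: linear_0)
    also have "\<dots> = (\<Sum>x\<in>range b. u x * metric42 v x)"
      by (simp add: linear_sum[OF lin] metric42_simps)
    also have "\<dots> = (\<Sum>x\<in>{v}. u x * metric42 v x)"
    proof (intro sum.mono_neutral_right ballI)
      fix x assume "x \<in> range b - {v}"
      then show "u x * metric42 v x = 0" using v orth by (metis DiffE imageE insertI1 mult_zero_right)
    qed (use v in auto)
    finally show False using v nonnull by auto
  qed
  then have "UNIV \<subseteq> span (range b)"
    using card_image[OF \<open>inj b\<close>] by (intro card_ge_dim_independent) (simp_all add: dim_UNIV)
  moreover have "span (range b) \<subseteq> {x. metric42 w x = 0}"
    by (rule span_minimal) (use perp in \<open>auto intro: linear_subspace_kernel lin\<close>)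
  ultimately have w: "metric42 w x = 0" for x by blast
  have "w $ i = 0" for i
  proof -
    have "metric42 w (axis i 1) = sig42 i * w $ i"
      by (simp add: metric42_def axis_def if_distrib cong: if_cong)
    then show ?thesis using w by (simp add: sig42_def split: if_splits)
  qed
  then show ?thesis by (simp add: vec_eq_iff)
qed

lemma lorentz_surface_open: "lorentz_surface U z \<Longrightarrow> open U"
  by (simp add: lorentz_surface_def)

text \<open>The discarded tangential part is orthogonal to every normal vector. So products with normal
  fields can be computed from the flat derivative instead of the normal part.\<close>

lemma normal_part_normal:
  assumes "lorentz_surface U z" "p \<in> U"
  shows "normal_part z p w \<in> normal_space z p"
    and "n \<in> normal_space z p \<Longrightarrow> metric42 (normal_part z p w) n = metric42 w n"
proof -
  have *: "normal_part z p w \<in> normal_space z p \<and> w - normal_part z p w \<in> tangent_space z p"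
    unfolding normal_part_def by (rule theI'[OF ex1_normal_part[OF assms]])
  then show "normal_part z p w \<in> normal_space z p" by simp
  assume "n \<in> normal_space z p"
  with * have "metric42 n (w - normal_part z p w) = 0" by (simp add: normal_space_def)
  then show "metric42 (normal_part z p w) n = metric42 w n"
    by (simp add: metric42_simps metric42_commute)
qed

lemma normal_space_add: "m \<in> normal_space z p \<Longrightarrow> n \<in> normal_space z p \<Longrightarrow> m + n \<in> normal_space z p"
  and normal_space_diff: "m \<in> normal_space z p \<Longrightarrow> n \<in> normal_space z p \<Longrightarrow> m - n \<in> normal_space z p"
  and normal_space_scaleR: "m \<in> normal_space z p \<Longrightarrow> c *\<^sub>R m \<in> normal_space z p"
  by (simp_all add: normal_space_def metric42_simps)

text \<open>A pseudo-orthonormal tangent basis together with \<open>n1\<close>, \<open>n2\<close> gives four orthogonal nonnull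
  vectors, so the difference of both sides vanishes because it is orthogonal to all of them.\<close>

lemma normal_frame_expansion:
  assumes z: "lorentz_surface U z" "p \<in> U"
    and n: "n \<in> normal_space z p" "n1 \<in> normal_space z p" "n2 \<in> normal_space z p"
    and nonnull: "metric42 n1 n1 \<noteq> 0" "metric42 n2 n2 \<noteq> 0" and orth: "metric42 n1 n2 = 0"
  shows "n = (metric42 n n1 / metric42 n1 n1) *\<^sub>R n1 + (metric42 n n2 / metric42 n2 n2) *\<^sub>R n2"
proof -
  obtain a b where ab: "first_fundamental_form z p a a = 1" "first_fundamental_form z p b b = - 1"
    "first_fundamental_form z p a b = 0"
    using z by (auto simp: lorentz_surface_def)
  define ta where "ta = dir_deriv z a p"
  define tb where "tb = dir_deriv z b p"
  define B :: "4 \<Rightarrow> real^4" where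
    "B i = (if i = 1 then ta else if i = 2 then tb else if i = 3 then n1 else n2)" for i
  define d where "d = n - ((metric42 n n1 / metric42 n1 n1) *\<^sub>R n1
      + (metric42 n n2 / metric42 n2 n2) *\<^sub>R n2)"
  have t: "metric42 ta ta = 1" "metric42 tb tb = - 1" "metric42 ta tb = 0"
    using ab by (simp_all add: first_fundamental_form_def ta_def tb_def)
  have nt: "metric42 m ta = 0" "metric42 m tb = 0" if "m \<in> normal_space z p" for m
    using that by (auto simp: normal_space_def tangent_space_def ta_def tb_def simp del: split_paired_All)
  have dn: "d \<in> normal_space z p"
    unfolding d_def by (intro normal_space_diff normal_space_add normal_space_scaleR n)
  have d12: "metric42 d n1 = 0" "metric42 d n2 = 0"
    using nonnull orth metric42_commute[of n2 n1] by (simp_all add: d_def metric42_simps)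
  have ij: "\<forall>i j. i \<noteq> j \<longrightarrow> metric42 (B i) (B j) = 0"
    using t nt[OF n(2)] nt[OF n(3)] orth
    by (simp add: forall_4 B_def) (simp add: metric42_commute)
  have ii: "\<forall>i. metric42 (B i) (B i) \<noteq> 0"
    using t nonnull by (simp add: forall_4 B_def)
  have di: "\<forall>i. metric42 d (B i) = 0"
    using nt[OF dn] d12 by (simp add: forall_4 B_def)
  have "d = 0" using zero_if_orthogonal_to_frame[of B d] ij ii di by blast
  then show ?thesis by (simp add: d_def)
qed

text \<open>The condition says that every derivative of \<open>N\<close> is orthogonal to the normal space, i.e. that
  \<open>D N = 0\<close>; phrased through products it can be used without computing normal parts.\<close>

definition parallel_normal_field ::
    "(real \<times> real) set \<Rightarrow> (real \<times> real \<Rightarrow> real^4) \<Rightarrow> (real \<times> real \<Rightarrow> real^4) \<Rightarrow> bool" where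
  "parallel_normal_field U z N \<longleftrightarrow> smooth_normal_field U z N \<and>
     (\<forall>p\<in>U. \<forall>w. \<forall>n\<in>normal_space z p. metric42 n (dir_deriv N w p) = 0)"

text \<open>The normal connection is metric: in the Leibniz rule for \<open>\<langle>\<eta>, N\<rangle>\<close> the term \<open>\<langle>\<eta>, dN\<rangle>\<close> vanishes.
  So the component along a parallel field of the covariant derivative is a plain derivative. The
  conditions on \<open>\<eta>\<close> concern the point \<open>p\<close> alone, so that the rule also applies to \<open>\<eta> = D\<^sub>Y \<xi>\<close>.\<close>

lemma metric42_normal_connection:
  assumes z: "lorentz_surface U z" and N: "parallel_normal_field U z N" and p: "p \<in> U"
    and \<eta>: "\<eta> p \<in> normal_space z p" "\<eta> differentiable (at p)"
  shows "metric42 (normal_connection z X \<eta> p) (N p) = dir_deriv (\<lambda>q. metric42 (\<eta> q) (N q)) (X p) p"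
proof -
  have "N differentiable (at p)" "N p \<in> normal_space z p"
    and par: "metric42 (\<eta> p) (dir_deriv N (X p) p) = 0"
    using N p \<eta>(1) unfolding parallel_normal_field_def smooth_normal_field_def
    by (blast intro: smooth_on_differentiable)+
  then have "metric42 (normal_connection z X \<eta> p) (N p) = metric42 (dir_deriv \<eta> (X p) p) (N p)"
    by (simp add: normal_connection_def normal_part_normal[OF z p])
  also have "\<dots> = metric42 (\<eta> p) (dir_deriv N (X p) p) + metric42 (dir_deriv \<eta> (X p) p) (N p)"
    by (simp add: par)
  also have "\<dots> = dir_deriv (\<lambda>q. metric42 (\<eta> q) (N q)) (X p) p"
    by (rule sym, rule dir_deriv_eqI)
       (intro bounded_bilinear.FDERIV[OF bounded_bilinear_metric42] has_derivative_dir_deriv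
         \<open>N differentiable (at p)\<close> \<eta>(2))
  finally show ?thesis .
qed

lemma metric42_normal_curvature_parallel:
  assumes z: "lorentz_surface U z" and N: "parallel_normal_field U z N" and p: "p \<in> U"
    and \<xi>: "smooth_normal_field U z \<xi>" and X: "smooth_tangent_field U X" and Y: "smooth_tangent_field U Y"
    and diff: "normal_connection z X \<xi> differentiable (at p)" "normal_connection z Y \<xi> differentiable (at p)"
  shows "metric42 (normal_curvature z X Y \<xi> p) (N p) = 0"
proof -
  define a where "a = (\<lambda>q. metric42 (\<xi> q) (N q))"
  have U: "open U" using z by (rule lorentz_surface_open)
  have C2: "Ck_on 2 U a"
    unfolding a_def using \<xi> N
    by (intro Ck_on_bilinear[OF bounded_bilinear_metric42 U])
       (auto simp: smooth_normal_field_def parallel_normal_field_def smooth_on_def)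
  have first: "metric42 (normal_connection z V \<xi> q) (N q) = dir_deriv a (V q) q" if "q \<in> U" for V q
    unfolding a_def using \<xi> that
    by (intro metric42_normal_connection[OF z N])
       (auto simp: smooth_normal_field_def intro: smooth_on_differentiable)
  have second: "metric42 (normal_connection z V (normal_connection z W \<xi>) p) (N p)
      = dir_deriv (\<lambda>q. dir_deriv a (W q) q) (V p) p"
    if "normal_connection z W \<xi> differentiable (at p)" for V W
  proof -
    have "metric42 (normal_connection z V (normal_connection z W \<xi>) p) (N p)
      = dir_deriv (\<lambda>q. metric42 (normal_connection z W \<xi> q) (N q)) (V p) p"
      using that
      by (intro metric42_normal_connection[OF z N p])
         (simp_all add: normal_connection_def normal_part_normal[OF z p])
    also have "\<dots> = dir_deriv (\<lambda>q. dir_deriv a (W q) q) (V p) p"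
      using first by (rule dir_deriv_cong_open[OF U p])
    finally show ?thesis .
  qed
  show ?thesis
    using lie_bracket_commutator(1)[OF U p C2, of X Y] X Y
    by (simp add: normal_curvature_def metric42_simps first[OF p] second diff smooth_tangent_field_def)
qed

text \<open>All frame components of the curvature vanish by the preceding lemma. What remains is that
  \<open>D\<^sub>X \<xi>\<close> is differentiable: as a normal part it is defined by a unique-choice operator, but its
  expansion in the frame has differentiable coefficients.\<close>

theorem flat_normal_connection_parallel_frame:
  assumes z: "lorentz_surface U z"
    and N1: "parallel_normal_field U z N1" and N2: "parallel_normal_field U z N2"
    and unit: "\<And>p. p \<in> U \<Longrightarrow> metric42 (N1 p) (N1 p) = \<sigma>1" "\<And>p. p \<in> U \<Longrightarrow> metric42 (N2 p) (N2 p) = \<sigma>2"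
    and nonnull: "\<sigma>1 \<noteq> 0" "\<sigma>2 \<noteq> 0"
    and orth: "\<And>p. p \<in> U \<Longrightarrow> metric42 (N1 p) (N2 p) = 0"
  shows "flat_normal_connection U z"
  unfolding flat_normal_connection_def
proof (intro allI impI ballI)
  fix X Y \<xi> p
  assume X: "smooth_tangent_field U X" and Y: "smooth_tangent_field U Y"
    and \<xi>: "smooth_normal_field U z \<xi>" and p: "p \<in> U"
  have U: "open U" using z by (rule lorentz_surface_open)
  have normal: "N1 q \<in> normal_space z q" "N2 q \<in> normal_space z q" if "q \<in> U" for q
    using N1 N2 that by (auto simp: parallel_normal_field_def smooth_normal_field_def)
  have expand: "n = (metric42 n (N1 q) / \<sigma>1) *\<^sub>R N1 q + (metric42 n (N2 q) / \<sigma>2) *\<^sub>R N2 q"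
    if "q \<in> U" "n \<in> normal_space z q" for n q
    using normal_frame_expansion[OF z that normal[OF that(1)]] unit orth nonnull that by simp
  have diff: "normal_connection z V \<xi> differentiable (at p)" if V: "smooth_tangent_field U V" for V
  proof -
    define c where "c N q = dir_deriv (\<lambda>q. metric42 (\<xi> q) (N q)) (V q) q" for N q
    have c: "metric42 (normal_connection z V \<xi> q) (N q) = c N q" "c N differentiable (at p)"
      "N differentiable (at p)"
      if "q \<in> U" and N: "parallel_normal_field U z N" for N q
    proof -
      show "metric42 (normal_connection z V \<xi> q) (N q) = c N q"
        unfolding c_def using \<xi> that
        by (intro metric42_normal_connection[OF z N])
           (auto simp: smooth_normal_field_def intro: smooth_on_differentiable)
      have C2: "Ck_on 2 U (\<lambda>q. metric42 (\<xi> q) (N q))"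
        using \<xi> N
        by (intro Ck_on_bilinear[OF bounded_bilinear_metric42 U])
           (auto simp: smooth_normal_field_def parallel_normal_field_def smooth_on_def)
      show "c N differentiable (at p)"
        unfolding c_def using lie_bracket_commutator(2)[OF U p C2, of V V] V
        by (simp add: smooth_tangent_field_def)
      show "N differentiable (at p)"
        using N p by (auto simp: parallel_normal_field_def smooth_normal_field_def
            intro: smooth_on_differentiable)
    qed
    have "normal_connection z V \<xi> q = (c N1 q / \<sigma>1) *\<^sub>R N1 q + (c N2 q / \<sigma>2) *\<^sub>R N2 q"
      if "q \<in> U" for q
      using expand[OF that, of "normal_connection z V \<xi> q"] c(1)[OF that N1] c(1)[OF that N2]
        normal_part_normal(1)[OF z that] by (simp add: normal_connection_def)
    moreover have "(\<lambda>q. (c N1 q / \<sigma>1) *\<^sub>R N1 q + (c N2 q / \<sigma>2) *\<^sub>R N2 q) differentiable (at p)"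
      using c(2,3)[OF p N1] c(2,3)[OF p N2]
      using nonnull by (auto intro!: derivative_intros)
    ultimately show ?thesis
      using differentiable_cong_open[OF U p, of "normal_connection z V \<xi>"] by simp
  qed
  have R: "normal_curvature z X Y \<xi> p \<in> normal_space z p"
    unfolding normal_curvature_def normal_connection_def
    by (intro normal_space_diff normal_part_normal(1)[OF z p])
  have "metric42 (normal_curvature z X Y \<xi> p) (N p) = 0" if "parallel_normal_field U z N" for N
    using metric42_normal_curvature_parallel[OF z that p \<xi> X Y diff[OF X] diff[OF Y]] .
  then show "normal_curvature z X Y \<xi> p = 0"
    using expand[OF p R] N1 N2 by simp
qed

text \<open>Differentiating the constant products of the frame shows that the matrix \<open>\<langle>dN\<^sub>i, N\<^sub>j\<rangle>\<close> is skew, so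
  in rank two its only independent entry is \<open>\<langle>dN\<^sub>1, N\<^sub>2\<rangle>\<close>, the normal torsion form. Hence no
  derivative of \<open>N2\<close> has to be computed.\<close>

lemma torsion_free_frame_parallel:
  assumes z: "lorentz_surface U z"
    and N1: "smooth_normal_field U z N1" and N2: "smooth_normal_field U z N2"
    and unit: "\<And>p. p \<in> U \<Longrightarrow> metric42 (N1 p) (N1 p) = \<sigma>1" "\<And>p. p \<in> U \<Longrightarrow> metric42 (N2 p) (N2 p) = \<sigma>2"
    and nonnull: "\<sigma>1 \<noteq> 0" "\<sigma>2 \<noteq> 0"
    and orth: "\<And>p. p \<in> U \<Longrightarrow> metric42 (N1 p) (N2 p) = 0"
    and torsion: "\<And>p w. p \<in> U \<Longrightarrow> metric42 (dir_deriv N1 w p) (N2 p) = 0"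
  shows "parallel_normal_field U z N1" "parallel_normal_field U z N2"
proof -
  have U: "open U" using z by (rule lorentz_surface_open)
  have normal: "N1 q \<in> normal_space z q" "N2 q \<in> normal_space z q"
    and diff: "N1 differentiable (at q)" "N2 differentiable (at q)" if "q \<in> U" for q
    using N1 N2 that by (auto simp: smooth_normal_field_def intro: smooth_on_differentiable)
  have leibniz: "metric42 (A p) (dir_deriv B w p) + metric42 (dir_deriv A w p) (B p) = 0"
    if "p \<in> U" "A differentiable (at p)" "B differentiable (at p)"
      and "\<And>q. q \<in> U \<Longrightarrow> metric42 (A q) (B q) = c" for A B c p w
  proof -
    have "((\<lambda>q. metric42 (A q) (B q)) has_derivative
        (\<lambda>w. metric42 (A p) (dir_deriv B w p) + metric42 (dir_deriv A w p) (B p))) (at p)"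
      using that by (intro bounded_bilinear.FDERIV[OF bounded_bilinear_metric42] has_derivative_dir_deriv)
    from dir_deriv_eqI[OF this] 
    have "metric42 (A p) (dir_deriv B w p) + metric42 (dir_deriv A w p) (B p)
        = dir_deriv (\<lambda>q. metric42 (A q) (B q)) w p" by simp
    also have "\<dots> = dir_deriv (\<lambda>q. c) w p"
      using that by (intro dir_deriv_cong_open[OF U]) auto
    also have "\<dots> = 0" by (rule dir_deriv_eqI) simp
    finally show ?thesis .
  qed
  have frame: "metric42 (N1 p) (dir_deriv N1 w p) = 0" "metric42 (N2 p) (dir_deriv N2 w p) = 0"
    "metric42 (N2 p) (dir_deriv N1 w p) = 0" "metric42 (N1 p) (dir_deriv N2 w p) = 0"
    if p: "p \<in> U" for p w
    using leibniz[OF p diff(1)[OF p] diff(1)[OF p] unit(1)]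
      leibniz[OF p diff(2)[OF p] diff(2)[OF p] unit(2)]
      leibniz[OF p diff(1)[OF p] diff(2)[OF p] orth] torsion[OF p]
      by (simp_all add: metric42_commute)
  have "metric42 n (dir_deriv N w p) = 0"
    if p: "p \<in> U" and n: "n \<in> normal_space z p" and N: "N \<in> {N1, N2}" for n p N w
  proof -
    have "metric42 n (dir_deriv N w p) =
      metric42 ((metric42 n (N1 p) / \<sigma>1) *\<^sub>R N1 p + (metric42 n (N2 p) / \<sigma>2) *\<^sub>R N2 p) (dir_deriv N w p)"
      using normal_frame_expansion[OF z p n normal[OF p]] unit orth nonnull p by simp
    also have "\<dots> = 0" using N frame[OF p, of w] by (auto simp: metric42_simps)
    finally show ?thesis .
  qed
  then show "parallel_normal_field U z N1" "parallel_normal_field U z N2"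
    using N1 N2 by (simp_all add: parallel_normal_field_def)
qed

section \<open>Meridian surfaces\<close>

text \<open>The generating curve of the surface; it lies in the light cone of the four-dimensional space.\<close>

definition cone_curve :: "(4 \<Rightarrow> real^4) \<Rightarrow> (real \<Rightarrow> real) \<Rightarrow> real \<Rightarrow> real^4" where
  "cone_curve e \<phi> v =
    (\<phi> v * cosh v) *\<^sub>R e 1 + (\<phi> v * sinh v) *\<^sub>R e 3 + ((\<phi> v)\<^sup>2 / 2) *\<^sub>R xi1 e + xi2 e"

text \<open>The velocity of \<open>cone_curve\<close>.\<close>

definition cone_tangent :: "(4 \<Rightarrow> real^4) \<Rightarrow> (real \<Rightarrow> real) \<Rightarrow> real \<Rightarrow> real^4" where
  "cone_tangent e \<phi> v =
    (deriv \<phi> v * cosh v + \<phi> v * sinh v) *\<^sub>R e 1 + (deriv \<phi> v * sinh v + \<phi> v * cosh v) *\<^sub>R e 3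
    + (\<phi> v * deriv \<phi> v) *\<^sub>R xi1 e"

text \<open>Up to a factor, the vector orthogonal to \<open>cone_curve\<close>, \<open>cone_tangent\<close> and \<open>xi1\<close>: the components along
  \<open>e 1\<close> and \<open>e 3\<close> of the velocity are interchanged, which in a Lorentz plane gives an orthogonal vector
  of opposite square, and the component along \<open>xi1\<close> then cancels the product with the curve.\<close>

definition cone_normal :: "(4 \<Rightarrow> real^4) \<Rightarrow> (real \<Rightarrow> real) \<Rightarrow> real \<Rightarrow> real^4" where
  "cone_normal e \<phi> v =
    (deriv \<phi> v * sinh v + \<phi> v * cosh v) *\<^sub>R e 1 + (deriv \<phi> v * cosh v + \<phi> v * sinh v) *\<^sub>R e 3
    + (\<phi> v)\<^sup>2 *\<^sub>R xi1 e"

lemma orthonormal_basis42D: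
  "orthonormal_basis42 e \<Longrightarrow> metric42 (e i) (e j) = (if i = j then sig42 i else 0)"
  by (simp add: orthonormal_basis42_def)

lemma metric42_minus: "metric42 (- x) y = - metric42 x y" "metric42 x (- y) = - metric42 x y"
  by (simp_all add: metric42_def sum_negf)

lemma xi_products:
  assumes "orthonormal_basis42 e"
  shows "metric42 (e 1) (e 1) = 1" "metric42 (e 3) (e 3) = - 1"
    "metric42 (e 1) (e 3) = 0" "metric42 (e 3) (e 1) = 0"
    "metric42 (xi1 e) (xi1 e) = 0" "metric42 (xi2 e) (xi2 e) = 0"
    "metric42 (xi1 e) (xi2 e) = - 1" "metric42 (xi2 e) (xi1 e) = - 1"
    "metric42 (e 1) (xi1 e) = 0" "metric42 (xi1 e) (e 1) = 0"
    "metric42 (e 1) (xi2 e) = 0" "metric42 (xi2 e) (e 1) = 0"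
    "metric42 (e 3) (xi1 e) = 0" "metric42 (xi1 e) (e 3) = 0"
    "metric42 (e 3) (xi2 e) = 0" "metric42 (xi2 e) (e 3) = 0"
  unfolding xi1_def xi2_def
  by (simp_all only: metric42_simps metric42_minus orthonormal_basis42D[OF assms])
     (simp_all add: sig42_def)

lemma cosh_mult_self:
  fixes v :: real
  shows "cosh v * cosh v = 1 + sinh v * sinh v"
    and "cosh v * (cosh v * x) = x + sinh v * (sinh v * x)"
proof -
  show c: "cosh v * cosh v = 1 + sinh v * sinh v"
    using cosh_square_eq[of v] by (simp add: power2_eq_square)
  show "cosh v * (cosh v * x) = x + sinh v * (sinh v * x)"
    using arg_cong[OF c, of "\<lambda>y. y * x"] by (simp add: algebra_simps)
qed

lemma cone_products:
  assumes "orthonormal_basis42 e"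
  shows "metric42 (cone_curve e \<phi> v) (cone_curve e \<phi> v) = 0"
    "metric42 (cone_curve e \<phi> v) (xi1 e) = - 1"
    "metric42 (cone_tangent e \<phi> v) (cone_tangent e \<phi> v) = (deriv \<phi> v)\<^sup>2 - (\<phi> v)\<^sup>2"
    "metric42 (cone_tangent e \<phi> v) (cone_curve e \<phi> v) = 0"
    "metric42 (cone_tangent e \<phi> v) (xi1 e) = 0"
    "metric42 (cone_normal e \<phi> v) (cone_normal e \<phi> v) = - ((deriv \<phi> v)\<^sup>2 - (\<phi> v)\<^sup>2)"
    "metric42 (cone_normal e \<phi> v) (cone_curve e \<phi> v) = 0"
    "metric42 (cone_normal e \<phi> v) (cone_tangent e \<phi> v) = 0"
    "metric42 (cone_normal e \<phi> v) (xi1 e) = 0"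
    "metric42 (xi1 e) (cone_curve e \<phi> v) = - 1"
    "metric42 (xi1 e) (cone_tangent e \<phi> v) = 0"
    "metric42 (cone_curve e \<phi> v) (cone_tangent e \<phi> v) = 0"
    "metric42 (xi1 e) (xi1 e) = 0"
  by (simp_all add: cone_curve_def cone_tangent_def cone_normal_def metric42_simps xi_products[OF assms])
     (simp_all add: power2_eq_square algebra_simps cosh_mult_self)

lemma has_vector_derivative_cone_curve:
  assumes "(\<phi> has_field_derivative deriv \<phi> v) (at v)"
  shows "(cone_curve e \<phi> has_vector_derivative cone_tangent e \<phi> v) (at v)"
  unfolding cone_curve_def[abs_def] cone_tangent_def
  by (rule derivative_eq_intros assms refl | simp)+
     (simp add: algebra_simps)

lemma meridian_surface_eq:
  "meridian_surface e f g \<phi> = (\<lambda>p. f (fst p) *\<^sub>R cone_curve e \<phi> (snd p) + g (fst p) *\<^sub>R xi1 e)"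
  by (simp add: meridian_surface_def cone_curve_def fun_eq_iff)

lemma smooth_on_cone:
  assumes "open J" "smooth_on J \<phi>"
  shows "smooth_on J (cone_curve e \<phi>)" "smooth_on J (cone_normal e \<phi>)"
  unfolding cone_curve_def[abs_def] cone_normal_def[abs_def] power2_eq_square divide_inverse
  by (intro smooth_on_add smooth_on_scaleR smooth_on_mult smooth_on_const smooth_on_cosh_sinh
      smooth_on_deriv(1) assms)+

text \<open>The sign \<open>\<epsilon>\<close> treats both causal types together: the \<open>v\<close>-direction has the sign of \<open>\<epsilon>\<close>, the
  \<open>u\<close>-direction the opposite one, and correspondingly \<open>N1\<close> has square \<open>- \<epsilon>\<close> and \<open>N2\<close> has square \<open>\<epsilon>\<close>.\<close>

locale meridian =
  fixes e :: "4 \<Rightarrow> real^4" and I J :: "real set" and f g \<phi> :: "real \<Rightarrow> real" and \<epsilon> :: real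
  assumes basis: "orthonormal_basis42 e"
    and open_I: "open I" and open_J: "open J"
    and smooth_f: "smooth_on I f" and smooth_g: "smooth_on I g" and smooth_phi: "smooth_on J \<phi>"
    and f_pos: "u \<in> I \<Longrightarrow> f u > 0"
    and eps: "\<epsilon> = 1 \<or> \<epsilon> = - 1"
    and phi_eps: "v \<in> J \<Longrightarrow> \<epsilon> * ((deriv \<phi> v)\<^sup>2 - (\<phi> v)\<^sup>2) > 0"
    and fg_eps: "u \<in> I \<Longrightarrow> \<epsilon> * (deriv f u * deriv g u) > 0"
begin

abbreviation "z \<equiv> meridian_surface e f g \<phi>"

abbreviation "U \<equiv> I \<times> J"

definition N1 :: "real \<times> real \<Rightarrow> real^4" where
  "N1 p = (\<epsilon> * ((deriv \<phi> (snd p))\<^sup>2 - (\<phi> (snd p))\<^sup>2)) powr (- 1/2) *\<^sub>R cone_normal e \<phi> (snd p)"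

definition N2 :: "real \<times> real \<Rightarrow> real^4" where
  "N2 p = (\<epsilon> * (2 * (deriv f (fst p) * deriv g (fst p)))) powr (- 1/2) *\<^sub>R
     (deriv f (fst p) *\<^sub>R cone_curve e \<phi> (snd p) - deriv g (fst p) *\<^sub>R xi1 e)"

lemma open_U: "open U"
  using open_I open_J by (rule open_Times)

lemma smooth_z: "smooth_on U z"
  unfolding meridian_surface_eq
  by (intro smooth_on_add smooth_on_scaleR smooth_on_const open_U
      smooth_on_fst[OF open_I open_J] smooth_on_snd[OF open_I open_J, of "cone_curve e \<phi>"]
      smooth_on_cone open_J smooth_f smooth_g smooth_phi)

lemma cone_curve_derivative:
  assumes "p \<in> U"
  shows "((\<lambda>p. cone_curve e \<phi> (snd p)) has_derivative (\<lambda>w. snd w *\<^sub>R cone_tangent e \<phi> (snd p))) (at p)"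
proof -
  have "(\<phi> has_field_derivative deriv \<phi> (snd p)) (at (snd p))"
    using assms by (intro smooth_on_deriv(2)[OF open_J smooth_phi]) auto
  from has_vector_derivative_cone_curve[OF this, unfolded has_vector_derivative_def]
  show ?thesis
    by (rule has_derivative_compose[OF bounded_linear_imp_has_derivative[OF bounded_linear_snd]])
qed

lemma dir_deriv_z:
  assumes "p \<in> U"
  shows "dir_deriv z w p = fst w *\<^sub>R (deriv f (fst p) *\<^sub>R cone_curve e \<phi> (snd p) + deriv g (fst p) *\<^sub>R xi1 e)
    + (snd w * f (fst p)) *\<^sub>R cone_tangent e \<phi> (snd p)"
proof -
  have d: "((\<lambda>p. h (fst p)) has_derivative (\<lambda>w. fst w * deriv h (fst p))) (at p)"
    if "smooth_on I h" for h
  proof -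
    have "(h has_field_derivative deriv h (fst p)) (at (fst p))"
      using assms by (intro smooth_on_deriv(2)[OF open_I that]) auto
    then have "(h has_derivative (\<lambda>x. x * deriv h (fst p))) (at (fst p))"
      by (simp add: has_field_derivative_def mult.commute[of _ "deriv h (fst p)"])
    then show ?thesis
      by (rule has_derivative_compose[OF bounded_linear_imp_has_derivative[OF bounded_linear_fst]])
  qed
  have "(z has_derivative (\<lambda>w. (f (fst p) *\<^sub>R (snd w *\<^sub>R cone_tangent e \<phi> (snd p))
      + (fst w * deriv f (fst p)) *\<^sub>R cone_curve e \<phi> (snd p))
      + (fst w * deriv g (fst p)) *\<^sub>R xi1 e)) (at p)"
    unfolding meridian_surface_eq
    by (intro has_derivative_add has_derivative_scaleR has_derivative_scaleR_left d
        cone_curve_derivative[OF assms] smooth_f smooth_g)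
  from dir_deriv_eqI[OF this, of w] show ?thesis by (simp add: algebra_simps)
qed

lemma fundamental_form:
  assumes "p \<in> U"
  shows "first_fundamental_form z p a b = fst a * fst b * (- 2 * (deriv f (fst p) * deriv g (fst p)))
    + snd a * snd b * ((f (fst p))\<^sup>2 * ((deriv \<phi> (snd p))\<^sup>2 - (\<phi> (snd p))\<^sup>2))"
  unfolding first_fundamental_form_def dir_deriv_z[OF assms]
  by (simp add: metric42_simps cone_products[OF basis] algebra_simps power2_eq_square)

text \<open>The coordinate directions are orthogonal, and their squares \<open>E = - 2 f' g'\<close> and \<open>G = f\<^sup>2 (\<phi>'\<^sup>2 - \<phi>\<^sup>2)\<close>
  have opposite signs, so it suffices to normalize them.\<close>

lemma lorentz: "lorentz_surface U z"
  unfolding lorentz_surface_def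
proof (intro conjI ballI open_U smooth_z)
  fix p assume p: "p \<in> U"
  define E where "E = - 2 * (deriv f (fst p) * deriv g (fst p))"
  define G where "G = (f (fst p))\<^sup>2 * ((deriv \<phi> (snd p))\<^sup>2 - (\<phi> (snd p))\<^sup>2)"
  define a where "a = (0 :: real, 1 / sqrt \<bar>G\<bar>)"
  define b where "b = (1 / sqrt \<bar>E\<bar>, 0 :: real)"
  have mem: "fst p \<in> I" "snd p \<in> J" using p by auto
  have E: "\<epsilon> * E < 0" using fg_eps[OF mem(1)] by (simp add: E_def)
  have "\<epsilon> * G = (f (fst p))\<^sup>2 * (\<epsilon> * ((deriv \<phi> (snd p))\<^sup>2 - (\<phi> (snd p))\<^sup>2))"
    by (simp add: G_def)
  also have "\<dots> > 0" using phi_eps[OF mem(2)] f_pos[OF mem(1)] by simp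
  finally have G: "\<epsilon> * G > 0" .
  have fff: "first_fundamental_form z p x y = fst x * fst y * E + snd x * snd y * G" for x y
    using fundamental_form[OF p] by (simp only: E_def G_def)
  have "first_fundamental_form z p a a = \<epsilon>" "first_fundamental_form z p b b = - \<epsilon>"
    "first_fundamental_form z p a b = 0" "first_fundamental_form z p b a = 0"
    using eps E G by (auto simp: fff a_def b_def)
  then show "\<exists>a b. first_fundamental_form z p a a = 1 \<and> first_fundamental_form z p b b = - 1 \<and>
      first_fundamental_form z p a b = 0"
    using eps by fastforce
qed

lemma normal_spaceI:
  assumes "p \<in> U"
    and "metric42 n (deriv f (fst p) *\<^sub>R cone_curve e \<phi> (snd p) + deriv g (fst p) *\<^sub>R xi1 e) = 0"
    and "metric42 n (cone_tangent e \<phi> (snd p)) = 0"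
  shows "n \<in> normal_space z p"
  using assms(2,3) dir_deriv_z[OF assms(1)]
  by (auto simp: normal_space_def tangent_space_def metric42_simps(2,6))

lemma smooth_normal:
  shows "smooth_normal_field U z N1" "smooth_normal_field U z N2"
proof -
  note pr = cone_products[OF basis]
  have "smooth_on U N1"
    unfolding N1_def[abs_def] power2_eq_square using phi_eps
    by (intro smooth_on_scaleR open_U smooth_on_powr smooth_on_mult smooth_on_diff smooth_on_const
        smooth_on_snd[OF open_I open_J, of "cone_normal e \<phi>"]
        smooth_on_snd[OF open_I open_J, of "deriv \<phi>"] smooth_on_snd[OF open_I open_J, of \<phi>]
        smooth_on_cone smooth_on_deriv(1) smooth_phi open_J) (auto simp: power2_eq_square)
  moreover have "smooth_on U N2"
    unfolding N2_def[abs_def] using fg_eps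
    by (intro smooth_on_scaleR open_U smooth_on_powr smooth_on_mult smooth_on_diff smooth_on_const
        smooth_on_snd[OF open_I open_J, of "cone_curve e \<phi>"]
        smooth_on_fst[OF open_I open_J, of "deriv f"] smooth_on_fst[OF open_I open_J, of "deriv g"]
        smooth_on_cone smooth_on_deriv(1) smooth_phi smooth_f smooth_g open_I open_J) auto
  moreover have "N1 p \<in> normal_space z p" "N2 p \<in> normal_space z p" if "p \<in> U" for p
    by (rule normal_spaceI[OF that]; simp add: N1_def N2_def metric42_simps pr)+
  ultimately show "smooth_normal_field U z N1" "smooth_normal_field U z N2"
    by (auto simp: smooth_normal_field_def)
qed

lemma powr_normalize:
  assumes "\<epsilon> * x > 0"
  shows "(\<epsilon> * x) powr (- 1/2) * ((\<epsilon> * x) powr (- 1/2) * x) = \<epsilon>"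
proof -
  have "(\<epsilon> * x) powr (- 1/2) * ((\<epsilon> * x) powr (- 1/2) * x) = x / (\<epsilon> * x)"
    using assms by (simp add: powr_add[symmetric] powr_minus_divide flip: mult.assoc)
  also have "\<dots> = \<epsilon>" using assms eps by auto
  finally show ?thesis .
qed

lemma frame_products:
  assumes "p \<in> U"
  shows "metric42 (N1 p) (N1 p) = - \<epsilon>" "metric42 (N2 p) (N2 p) = \<epsilon>" "metric42 (N1 p) (N2 p) = 0"
proof -
  note pr = cone_products[OF basis]
  have pos: "\<epsilon> * ((deriv \<phi> (snd p))\<^sup>2 - (\<phi> (snd p))\<^sup>2) > 0"
    "\<epsilon> * (2 * (deriv f (fst p) * deriv g (fst p))) > 0"
    using assms phi_eps[of "snd p"] fg_eps[of "fst p"] by auto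
  show "metric42 (N1 p) (N1 p) = - \<epsilon>"
    unfolding N1_def metric42_simps(5,6) pr mult_minus_right powr_normalize[OF pos(1)] ..
  have "metric42 (deriv f (fst p) *\<^sub>R cone_curve e \<phi> (snd p) - deriv g (fst p) *\<^sub>R xi1 e)
      (deriv f (fst p) *\<^sub>R cone_curve e \<phi> (snd p) - deriv g (fst p) *\<^sub>R xi1 e)
    = 2 * (deriv f (fst p) * deriv g (fst p))"
    by (simp add: metric42_simps pr)
  then show "metric42 (N2 p) (N2 p) = \<epsilon>"
    unfolding N2_def by (simp only: metric42_simps(5,6) powr_normalize[OF pos(2)])
  show "metric42 (N1 p) (N2 p) = 0"
    by (simp add: N1_def N2_def metric42_simps pr)
qed

lemma N1_perp:
  "metric42 (N1 p) (cone_curve e \<phi> (snd p)) = 0" "metric42 (N1 p) (cone_tangent e \<phi> (snd p)) = 0"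
  "metric42 (N1 p) (xi1 e) = 0"
  by (simp_all add: N1_def metric42_simps cone_products[OF basis])

text \<open>\<open>N2\<close> is a combination of the curve and \<open>xi1\<close>. Both are orthogonal to \<open>N1\<close>, and so are
  their derivatives, the tangent and \<open>0\<close>. By the Leibniz rule they are orthogonal to the derivatives
  of \<open>N1\<close>, which therefore need not be known.\<close>

lemma torsion_free:
  assumes p: "p \<in> U"
  shows "metric42 (dir_deriv N1 w p) (N2 p) = 0"
proof -
  have N1: "(N1 has_derivative (\<lambda>w. dir_deriv N1 w p)) (at p)"
    using smooth_normal(1) p
    by (auto simp: smooth_normal_field_def intro: has_derivative_dir_deriv smooth_on_differentiable)
  have "((\<lambda>q. metric42 (N1 q) (cone_curve e \<phi> (snd q))) has_derivative
      (\<lambda>w. metric42 (N1 p) (snd w *\<^sub>R cone_tangent e \<phi> (snd p))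
        + metric42 (dir_deriv N1 w p) (cone_curve e \<phi> (snd p)))) (at p)"
    by (rule bounded_bilinear.FDERIV[OF bounded_bilinear_metric42 N1 cone_curve_derivative[OF p]])
  then have "((\<lambda>q. 0) has_derivative
      (\<lambda>w. metric42 (dir_deriv N1 w p) (cone_curve e \<phi> (snd p)))) (at p)"
    by (simp add: N1_perp metric42_simps)
  then have "metric42 (dir_deriv N1 w p) (cone_curve e \<phi> (snd p)) = 0" for w
    using has_derivative_unique[OF _ has_derivative_const] by metis
  moreover have "((\<lambda>q. metric42 (N1 q) (xi1 e)) has_derivative
      (\<lambda>w. metric42 (dir_deriv N1 w p) (xi1 e))) (at p)"
    by (rule bounded_linear.has_derivative
        [OF bounded_bilinear.bounded_linear_left[OF bounded_bilinear_metric42] N1])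
  then have "((\<lambda>q. 0) has_derivative (\<lambda>w. metric42 (dir_deriv N1 w p) (xi1 e))) (at p)"
    by (simp add: N1_perp)
  then have "metric42 (dir_deriv N1 w p) (xi1 e) = 0" for w
    using has_derivative_unique[OF _ has_derivative_const] by metis
  ultimately show ?thesis by (simp add: N2_def metric42_simps)
qed

lemma flat: "flat_normal_connection U z"
proof (rule flat_normal_connection_parallel_frame[OF lorentz _ _ frame_products(1,2) _ _ frame_products(3)])
  show "parallel_normal_field U z N1" "parallel_normal_field U z N2"
    using torsion_free_frame_parallel[OF lorentz smooth_normal frame_products(1,2) _ _ frame_products(3) torsion_free] eps
    by auto
qed (use eps in auto)

end

theorem proposition1:
  fixes e :: "4 \<Rightarrow> real^4" and I J :: "real set" and f g \<phi> :: "real \<Rightarrow> real"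
  assumes "orthonormal_basis42 e"
    and "open I" and "is_interval I" and "open J" and "is_interval J"
    and "smooth_on I f" and "smooth_on I g" and "smooth_on J \<phi>"
    and "\<forall>u\<in>I. f u > 0"
    and "((\<forall>v\<in>J. (deriv \<phi> v)\<^sup>2 - (\<phi> v)\<^sup>2 > 0) \<and> (\<forall>u\<in>I. deriv f u * deriv g u > 0)) \<or>
         ((\<forall>v\<in>J. (deriv \<phi> v)\<^sup>2 - (\<phi> v)\<^sup>2 < 0) \<and> (\<forall>u\<in>I. deriv f u * deriv g u < 0))"
  shows "lorentz_surface (I \<times> J) (meridian_surface e f g \<phi>) \<and>
         flat_normal_connection (I \<times> J) (meridian_surface e f g \<phi>)"
proof -
  from assms(10) obtain \<epsilon> :: real where "\<epsilon> = 1 \<or> \<epsilon> = - 1"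
    and "\<And>v. v \<in> J \<Longrightarrow> \<epsilon> * ((deriv \<phi> v)\<^sup>2 - (\<phi> v)\<^sup>2) > 0"
    and "\<And>u. u \<in> I \<Longrightarrow> \<epsilon> * (deriv f u * deriv g u) > 0"
    by (elim disjE conjE) (force, force intro: that[of "- 1"])
  then interpret meridian e I J f g \<phi> \<epsilon>
    using assms by unfold_locales auto
  from lorentz flat show ?thesis ..
qed

end
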